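(* Assume that $\mathbb{S}(\Omega)\subset\Omega$. (1) If $\mathbb{H}_0(\Omega)\subset\Omega$, then, for any $\langle r\rangle\in R(\Omega)$, there is an automorphism $\pi$ of $\Gamma(\Omega,q)$ such that $\pi(\langle r\rangle)=\langle 0\rangle_0$. (2) If $\mathbb{H}_1(\Omega)\subset\Omega$, then, for any $[l]\in L(\Omega)$, there is an automorphism $\pi$ of $\Gamma(\Omega,q)$ such that $\pi([l])=[0]_0$.
   Context: Let $q$ be a prime power and $\mathbb{F}_q$ the field with $q$ elements. $\{0,1\}^*$ is the set of finite binary sequences, $\eta$ the null sequence; juxtaposition is concatenation. $\Omega\subset\{0,1\}^*$ is a finite set satisfying condition C1: $\eta\in\Omega$, and for any $\alpha\in\Omega\setminus\{\eta\}$ the sequence obtained by deleting the last bit of $\alpha$ is in $\Omega$. $L(\Omega)$ and $R(\Omega)$ are two disjoint copies of $\mathbb{F}_q^{|\Omega|+1}$; their vectors are written $[l]$ and $\langle r\rangle$ respectively, with entries indexed by $\Omega\cup\{*\}$, where $*\notin\Omega$ is an extra symbol. $[0]_0\in L(\Omega)$ and $\langle 0\rangle_0\in R(\Omega)$ are the all-zero vectors. $\Gamma(\Omega,q)$ is the bipartite graph with vertex set $L(\Omega)\cup R(\Omega)$ in which $[l]\in L(\Omega)$ and $\langle r\rangle\in R(\Omega)$ are adjacent if and only if $l_\eta+r_\eta=l_*r_*$, $l_{\alpha0}+r_{\alpha0}=r_*l_\alpha$ for all $\alpha0\in\Omega$, and $l_{\beta1}+r_{\beta1}=l_*r_\beta$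 for all $\beta1\in\Omega$ (here $\alpha,\beta\in\{0,1\}^*$). For $\alpha\in\Omega$, $S_\Omega(\alpha)$ is the set of $\beta\in\{0,1\}^*$ with $\{\alpha01\beta,\alpha10\beta\}\cap\Omega\ne\emptyset$, and $\mathbb{S}(\Omega)=\bigcup_{\alpha\in\Omega}S_\Omega(\alpha)$. For $a\in\{0,1\}$, $\mathbb{H}_a(\Omega)$ is the set of all binary sequences obtained from sequences in $\Omega$ by a finite number (possibly zero) of iterated deletions, each of which deletes a symbol $a$ either from the first position (when the first bit is $a$) or from two consecutive $a$'s (replacing some block $aa$ by $a$). *)

theory Defs
  imports "HOL-Library.FuncSet"
begin

text \<open>A bit is a Boolean, with \<open>False\<close> for 0 and \<open>True\<close> for 1; the null sequence is \<open>[]\<close>.\<close>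

type_synonym bits = "bool list"

definition cond_C1 :: "bits set \<Rightarrow> bool" where
  "cond_C1 \<Omega> \<longleftrightarrow> [] \<in> \<Omega> \<and> (\<forall>\<alpha> \<in> \<Omega> - {[]}. butlast \<alpha> \<in> \<Omega>)"

definition S_at :: "bits set \<Rightarrow> bits \<Rightarrow> bits set" where
  "S_at \<Omega> \<alpha> = {\<beta>. {\<alpha> @ [False, True] @ \<beta>, \<alpha> @ [True, False] @ \<beta>} \<inter> \<Omega> \<noteq> {}}"

definition S_all :: "bits set \<Rightarrow> bits set" where
  "S_all \<Omega> = (\<Union>\<alpha>\<in>\<Omega>. S_at \<Omega> \<alpha>)"

inductive del_step :: "bool \<Rightarrow> bits \<Rightarrow> bits \<Rightarrow> bool" for a :: bool where
  del_first: "del_step a (a # w) w"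
| del_double: "del_step a (u @ [a, a] @ v) (u @ [a] @ v)"

definition H_set :: "bool \<Rightarrow> bits set \<Rightarrow> bits set" where
  "H_set a \<Omega> = {\<beta>. \<exists>\<alpha>\<in>\<Omega>. (del_step a)\<^sup>*\<^sup>* \<alpha> \<beta>}"

text \<open>A graph is a pair of its vertex set and its set of (unordered) edges.\<close>

type_synonym 'v graph = "'v set \<times> 'v set set"

definition graph_automorphism :: "'v graph \<Rightarrow> ('v \<Rightarrow> 'v) \<Rightarrow> bool" where
  "graph_automorphism G \<pi> \<longleftrightarrow>
     bij_betw \<pi> (fst G) (fst G) \<and>
     (\<forall>u \<in> fst G. \<forall>v \<in> fst G. {u, v} \<in> snd G \<longleftrightarrow> {\<pi> u, \<pi> v} \<in> snd G)"

text \<open>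
  Vectors are indexed by \<open>\<Omega>\<close> together with one extra symbol: \<open>Some \<alpha>\<close> is the
  index \<open>\<alpha>\<close> and \<open>None\<close> is the extra symbol. They are extensional functions,
  that is, equal to \<^const>\<open>undefined\<close> outside the index set, so that two vectors are equal
  exactly when their entries are.
\<close>

type_synonym 'f vec = "bits option \<Rightarrow> 'f"

definition indices :: "bits set \<Rightarrow> bits option set" where
  "indices \<Omega> = insert None (Some ` \<Omega>)"

definition vectors :: "bits set \<Rightarrow> 'f vec set" where
  "vectors \<Omega> = (indices \<Omega> \<rightarrow>\<^sub>E UNIV)"

definition zero_vector :: "bits set \<Rightarrow> ('f::zero) vec" where
  "zero_vector \<Omega> = (\<lambda>i\<in>indices \<Omega>. 0)"

datatype 'f vertex = Lvert "'f vec" | Rvert "'f vec"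

definition L_verts :: "bits set \<Rightarrow> 'f vertex set" where
  "L_verts \<Omega> = Lvert ` vectors \<Omega>"

definition R_verts :: "bits set \<Rightarrow> 'f vertex set" where
  "R_verts \<Omega> = Rvert ` vectors \<Omega>"

definition incident :: "bits set \<Rightarrow> ('f::field) vec \<Rightarrow> 'f vec \<Rightarrow> bool" where
  "incident \<Omega> l r \<longleftrightarrow>
     l (Some []) + r (Some []) = l None * r None \<and>
     (\<forall>\<alpha>. \<alpha> @ [False] \<in> \<Omega> \<longrightarrow>
        l (Some (\<alpha> @ [False])) + r (Some (\<alpha> @ [False])) = r None * l (Some \<alpha>)) \<and>
     (\<forall>\<beta>. \<beta> @ [True] \<in> \<Omega> \<longrightarrow>
        l (Some (\<beta> @ [True])) + r (Some (\<beta> @ [True])) = l None * r (Some \<beta>))"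

text \<open>The field, and hence its number of elements, is given by the type \<open>'f\<close>.\<close>

definition Gamma :: "bits set \<Rightarrow> ('f::field) vertex graph" where
  "Gamma \<Omega> =
     (L_verts \<Omega> \<union> R_verts \<Omega>,
      {{Lvert l, Rvert r} | l r. l \<in> vectors \<Omega> \<and> r \<in> vectors \<Omega> \<and> incident \<Omega> l r})"

end

theory Submission
  imports Defs "HOL-Library.Sublist"
begin

text \<open>
  Any map of the vertex set that sends left vertices to left vertices, right vertices to right
  vertices, is injective and preserves incidence is an automorphism, because the graph is finite.
  Two families of such maps move an arbitrary right vertex to zero.

  The first family translates \<open>r\<^sub>*\<close> by a constant \<open>x\<close>. The equations then force the other entries:
  \<open>l\<^sub>\<eta>\<close> must absorb \<open>x l\<^sub>*\<close>, then \<open>l\<^sub>\<alpha>\<^sub>0\<close> must absorb \<open>x l\<^sub>\<alpha>\<close>, and so on. The new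
  entry at \<open>\<alpha>\<close> is a linear combination of old entries at sequences obtained from \<open>\<alpha>\<close> by
  shortening its runs of zeros, with binomial coefficients times powers of \<open>x\<close>. The new left entry
  may also use a proper prefix of such a sequence. These sequences lie in \<open>\<Omega>\<close> by closure under the
  deletions of 0 and under prefixes (\<open>term_reachable\<close>, \<open>lterm_mem\<close>), so the map makes sense on
  \<open>\<Omega>\<close>-indexed vectors and preserves incidence (\<open>translate_incident\<close>). Translation by \<open>- x\<close> is its
  inverse (\<open>shift_inverse\<close>).

  The second family adds a constant \<open>c\<close> to \<open>r\<^sub>\<alpha>\<close> for one \<open>\<alpha> \<in> \<Omega>\<close>, and subtracts it from \<open>l\<^sub>\<alpha>\<close>.
  This disturbs the equations at \<open>\<alpha>0\<close> by \<open>- c r\<^sub>*\<close> and at \<open>\<alpha>1\<close> by \<open>c l\<^sub>*\<close>. Corrected on the other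
  side, these errors become \<open>- c l\<^sub>* r\<^sub>* = - c (l\<^sub>\<eta> + r\<^sub>\<eta>)\<close> at \<open>\<alpha>01\<close>
  and \<open>c (l\<^sub>\<eta> + r\<^sub>\<eta>)\<close> at \<open>\<alpha>10\<close>, while
  \<open>\<alpha>00\<close> and \<open>\<alpha>11\<close> are not disturbed at all. From there on, adding the multiples \<open>- c\<close> and \<open>c\<close>
  of the entries at \<open>\<beta>\<close> to the entries at \<open>\<alpha>01\<beta>\<close> and \<open>\<alpha>10\<beta>\<close> repairs everything, since the
  equations are linear and \<open>\<beta> \<in> \<Omega>\<close> by the hypothesis on \<open>\<S>(\<Omega>)\<close> (\<open>kick_incident\<close>).

  One translation makes \<open>r\<^sub>*\<close> zero. The entries at the sequences in \<open>\<Omega>\<close> are then cleared by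
  maps of the second family. Each of these maps changes, apart from \<open>r\<^sub>\<alpha>\<close>, only entries at
  extensions of \<open>\<alpha>\<close>, so clearing in an order of increasing length never spoils an earlier zero
  (\<open>clear_right_vertex\<close>).

  Left vertices are handled by duality: complementing all bits and exchanging the two sides turns
  the graph of \<open>\<Omega>\<close> into that of the complemented set, and exchanges the deletions of 0 and of 1.
\<close>

section \<open>Automorphisms of finite graphs\<close>

text \<open>
  Injectivity on vertices makes the induced map on edges injective too. As there are finitely many
  edges, every edge is then hit, so edges are reflected and not only preserved.
\<close>

lemma graph_automorphismI:
  assumes fin: "finite V" and sub: "E \<subseteq> Pow V"
    and inj: "inj_on \<pi> V" and maps: "\<pi> ` V \<subseteq> V"
    and edges: "\<And>e. e \<in> E \<Longrightarrow> \<pi> ` e \<in> E"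
  shows "graph_automorphism (V, E) \<pi>"
proof -
  have finE: "finite E"
    using fin sub finite_subset by auto
  have injE: "inj_on ((`) \<pi>) E"
    using inj_on_image_Pow[OF inj] sub inj_on_subset by blast
  have surjE: "(`) \<pi> ` E = E"
    using endo_inj_surj[OF finE _ injE] edges by auto
  have edge_iff: "{u, v} \<in> E \<longleftrightarrow> {\<pi> u, \<pi> v} \<in> E" if uv: "u \<in> V" "v \<in> V" for u v
  proof
    show "{\<pi> u, \<pi> v} \<in> E" if "{u, v} \<in> E"
      using edges[OF that] by simp
    show "{u, v} \<in> E" if "{\<pi> u, \<pi> v} \<in> E"
    proof -
      have "\<pi> ` {u, v} \<in> (`) \<pi> ` E"
        unfolding surjE using that by simp
      then obtain e where e: "e \<in> E" "\<pi> ` e = \<pi> ` {u, v}"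
        by (elim imageE) simp
      have "e \<subseteq> V" "{u, v} \<subseteq> V"
        using e(1) sub uv by auto
      then have "e = {u, v}"
        using inj_on_image_eq_iff[OF inj, of e "{u, v}"] e(2) by simp
      then show ?thesis using e(1) by simp
    qed
  qed
  show ?thesis
    unfolding graph_automorphism_def bij_betw_def fst_conv snd_conv
    by (intro conjI ballI inj endo_inj_surj[OF fin maps inj] edge_iff)
qed

lemma graph_automorphism_compose:
  assumes \<pi>: "graph_automorphism G \<pi>" and \<rho>: "graph_automorphism G \<rho>"
  shows "graph_automorphism G (\<rho> \<circ> \<pi>)"
  unfolding graph_automorphism_def comp_apply
proof (intro conjI ballI)
  have \<pi>_bij: "bij_betw \<pi> (fst G) (fst G)"
    using \<pi> by (simp add: graph_automorphism_def)
  moreover have "bij_betw \<rho> (fst G) (fst G)"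
    using \<rho> by (simp add: graph_automorphism_def)
  ultimately show "bij_betw (\<lambda>x. \<rho> (\<pi> x)) (fst G) (fst G)"
    unfolding comp_def[symmetric] by (rule bij_betw_trans)
  fix u v assume uv: "u \<in> fst G" "v \<in> fst G"
  then have "\<pi> u \<in> fst G" "\<pi> v \<in> fst G"
    using \<pi>_bij by (auto dest: bij_betwE)
  then have "{\<pi> u, \<pi> v} \<in> snd G \<longleftrightarrow> {\<rho> (\<pi> u), \<rho> (\<pi> v)} \<in> snd G"
    using \<rho> unfolding graph_automorphism_def by blast
  moreover have "{u, v} \<in> snd G \<longleftrightarrow> {\<pi> u, \<pi> v} \<in> snd G"
    using \<pi> uv unfolding graph_automorphism_def by blast
  ultimately show "{u, v} \<in> snd G \<longleftrightarrow> {\<rho> (\<pi> u), \<rho> (\<pi> v)} \<in> snd G"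
    by (rule trans[rotated])
qed

section \<open>Automorphisms of the graph given by a pair of vector maps\<close>

lemma mem_indices [simp]: "None \<in> indices \<Omega>" "Some w \<in> indices \<Omega> \<longleftrightarrow> w \<in> \<Omega>"
  by (auto simp: indices_def)

lemma restrict_mem_vectors [simp]: "restrict f (indices \<Omega>) \<in> vectors \<Omega>"
  by (simp add: vectors_def)

lemma vectors_eqI:
  assumes "l \<in> vectors \<Omega>" "m \<in> vectors \<Omega>" "l None = m None"
    and "\<And>w. w \<in> \<Omega> \<Longrightarrow> l (Some w) = m (Some w)"
  shows "l = m"
  using assms unfolding vectors_def
  by (intro PiE_ext[of l "indices \<Omega>" _ m]) (auto simp: indices_def)

lemma finite_vectors:
  "finite \<Omega> \<Longrightarrow> finite (vectors \<Omega> :: ('f::finite) vec set)"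
  unfolding vectors_def indices_def by (intro finite_PiE) auto

lemma fst_Gamma: "fst (Gamma \<Omega>) = L_verts \<Omega> \<union> R_verts \<Omega>"
  by (simp add: Gamma_def)

lemma Lvert_Rvert_edge_iff:
  "{Lvert l, Rvert r} \<in> snd (Gamma \<Omega>) \<longleftrightarrow>
     l \<in> vectors \<Omega> \<and> r \<in> vectors \<Omega> \<and> incident \<Omega> l r"
  by (auto simp: Gamma_def doubleton_eq_iff)

lemma Rvert_Lvert_edge_iff:
  "{Rvert r, Lvert l} \<in> snd (Gamma \<Omega>) \<longleftrightarrow>
     l \<in> vectors \<Omega> \<and> r \<in> vectors \<Omega> \<and> incident \<Omega> l r"
  by (subst insert_commute) (rule Lvert_Rvert_edge_iff)

fun side_map :: "('f vec \<Rightarrow> 'f vec) \<Rightarrow> ('f vec \<Rightarrow> 'f vec) \<Rightarrow> 'f vertex \<Rightarrow> 'f vertex" where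
  "side_map \<phi> \<psi> (Lvert l) = Lvert (\<phi> l)"
| "side_map \<phi> \<psi> (Rvert r) = Rvert (\<psi> r)"

lemma side_map_automorphism:
  fixes \<phi> \<psi> :: "('f::{field,finite}) vec \<Rightarrow> 'f vec"
  assumes "finite \<Omega>"
    and \<phi>: "inj_on \<phi> (vectors \<Omega>)" "\<And>l. \<phi> l \<in> vectors \<Omega>"
    and \<psi>: "inj_on \<psi> (vectors \<Omega>)" "\<And>r. \<psi> r \<in> vectors \<Omega>"
    and incidence: "\<And>l r. incident \<Omega> l r \<Longrightarrow> incident \<Omega> (\<phi> l) (\<psi> r)"
  shows "graph_automorphism (Gamma \<Omega>) (side_map \<phi> \<psi>)"
  unfolding Gamma_def
proof (rule graph_automorphismI)
  show "finite (L_verts \<Omega> \<union> R_verts \<Omega> :: 'f vertex set)"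
    unfolding L_verts_def R_verts_def by (intro finite_UnI finite_imageI finite_vectors assms(1))
  show "inj_on (side_map \<phi> \<psi>) (L_verts \<Omega> \<union> R_verts \<Omega>)"
    by (rule inj_onI)
      (auto simp: L_verts_def R_verts_def inj_on_eq_iff[OF \<phi>(1)] inj_on_eq_iff[OF \<psi>(1)])
  show "side_map \<phi> \<psi> ` (L_verts \<Omega> \<union> R_verts \<Omega>) \<subseteq> L_verts \<Omega> \<union> R_verts \<Omega>"
    using \<phi>(2) \<psi>(2) by (auto simp: L_verts_def R_verts_def)
  show "{{Lvert l, Rvert r} | l r. l \<in> vectors \<Omega> \<and> r \<in> vectors \<Omega> \<and> incident \<Omega> l r}
      \<subseteq> Pow (L_verts \<Omega> \<union> R_verts \<Omega> :: 'f vertex set)"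
    by (auto simp: L_verts_def R_verts_def)
next
  fix e :: "'f vertex set"
  assume "e \<in> {{Lvert l, Rvert r} | l r. l \<in> vectors \<Omega> \<and> r \<in> vectors \<Omega> \<and> incident \<Omega> l r}"
  then obtain l r where e: "e = {Lvert l, Rvert r}" and lr: "incident \<Omega> l r"
    by blast
  have "side_map \<phi> \<psi> ` e = {Lvert (\<phi> l), Rvert (\<psi> r)}"
    by (simp add: e)
  then show "side_map \<phi> \<psi> ` e
      \<in> {{Lvert l, Rvert r} | l r. l \<in> vectors \<Omega> \<and> r \<in> vectors \<Omega> \<and> incident \<Omega> l r}"
    using \<phi>(2) \<psi>(2) incidence[OF lr] by blast
qed

section \<open>Translating the entry at the extra index\<close>

text \<open>
  Appending 0 to the extra index gives the null sequence: with this convention the equation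
  \<open>l\<^sub>\<eta> + r\<^sub>\<eta> = r\<^sub>* l\<^sub>*\<close> is the instance \<open>\<alpha> = *\<close> of the equations at \<open>\<alpha>0\<close>.
\<close>

fun append0 :: "bits option \<Rightarrow> bits" where
  "append0 None = []"
| "append0 (Some \<beta>) = \<beta> @ [False]"

text \<open>
  The left and right entries at \<open>\<alpha>\<close> after translating \<open>r\<^sub>*\<close> by \<open>x\<close>, as linear functionals of
  all old entries. They are read off from the last bit, hence the recursion on the reversed
  sequence. If the new \<open>r\<^sub>\<alpha>\<close> is \<open>\<Sum>\<^sub>\<beta> b\<^sub>\<beta> r\<^sub>\<beta>\<close>, then at \<open>\<alpha>1\<close> the right-hand side
  \<open>l\<^sub>* \<Sum>\<^sub>\<beta> b\<^sub>\<beta> r\<^sub>\<beta>\<close> equals \<open>\<Sum>\<^sub>\<beta> b\<^sub>\<beta> (l\<^sub>\<beta>\<^sub>1 + r\<^sub>\<beta>\<^sub>1)\<close>, which is split into its left and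
  right parts. If the new \<open>l\<^sub>\<alpha>\<close> is \<open>\<Sum>\<^sub>\<beta> a\<^sub>\<beta> l\<^sub>\<beta>\<close>, then at \<open>\<alpha>0\<close> the right-hand side
  \<open>(r\<^sub>* + x) \<Sum>\<^sub>\<beta> a\<^sub>\<beta> l\<^sub>\<beta>\<close> equals \<open>\<Sum>\<^sub>\<beta> a\<^sub>\<beta> (l\<^sub>\<beta>\<^sub>0 + r\<^sub>\<beta>\<^sub>0 + x l\<^sub>\<beta>)\<close>, split in the same way.
  Changing the argument function represents the passage from \<open>\<beta>\<close> to \<open>\<beta>1\<close> or \<open>\<beta>0\<close> without naming
  any coefficients.
\<close>

fun lshift_rev :: "'f::field \<Rightarrow> bits \<Rightarrow> (bits option \<Rightarrow> 'f) \<Rightarrow> 'f"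
  and rshift_rev :: "'f::field \<Rightarrow> bits \<Rightarrow> (bits \<Rightarrow> 'f) \<Rightarrow> 'f" where
  "lshift_rev x [] f = f (Some []) + x * f None"
| "lshift_rev x (True # w) f = rshift_rev x w (\<lambda>\<beta>. f (Some (\<beta> @ [True])))"
| "lshift_rev x (False # w) f = lshift_rev x w (\<lambda>\<beta>. f (Some (append0 \<beta>)) + x * f \<beta>)"
| "rshift_rev x [] f = f []"
| "rshift_rev x (True # w) f = rshift_rev x w (\<lambda>\<beta>. f (\<beta> @ [True]))"
| "rshift_rev x (False # w) f = lshift_rev x w (\<lambda>\<beta>. f (append0 \<beta>))"

definition lshift :: "'f::field \<Rightarrow> bits \<Rightarrow> (bits option \<Rightarrow> 'f) \<Rightarrow> 'f" where
  "lshift x \<alpha> = lshift_rev x (rev \<alpha>)"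

definition rshift :: "'f::field \<Rightarrow> bits \<Rightarrow> (bits \<Rightarrow> 'f) \<Rightarrow> 'f" where
  "rshift x \<alpha> = rshift_rev x (rev \<alpha>)"

lemma lshift_simps [simp]:
  "lshift x [] f = f (Some []) + x * f None"
  "lshift x (\<alpha> @ [True]) f = rshift x \<alpha> (\<lambda>\<beta>. f (Some (\<beta> @ [True])))"
  "lshift x (\<alpha> @ [False]) f = lshift x \<alpha> (\<lambda>\<beta>. f (Some (append0 \<beta>)) + x * f \<beta>)"
  by (simp_all add: lshift_def rshift_def)

lemma rshift_simps [simp]:
  "rshift x [] f = f []"
  "rshift x (\<alpha> @ [True]) f = rshift x \<alpha> (\<lambda>\<beta>. f (\<beta> @ [True]))"
  "rshift x (\<alpha> @ [False]) f = lshift x \<alpha> (\<lambda>\<beta>. f (append0 \<beta>))"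
  by (simp_all add: lshift_def rshift_def)

lemma bits_snoc_induct [case_names Nil snoc0 snoc1]:
  assumes "P []" "\<And>\<alpha>. P \<alpha> \<Longrightarrow> P (\<alpha> @ [False])" "\<And>\<alpha>. P \<alpha> \<Longrightarrow> P (\<alpha> @ [True])"
  shows "P \<alpha>"
proof (induction \<alpha> rule: rev_induct)
  case (snoc b \<alpha>)
  then show ?case using assms(2,3) by (cases b) auto
qed (rule assms(1))

lemma shift_add:
  "lshift x \<alpha> (\<lambda>\<beta>. f \<beta> + g \<beta>) = lshift x \<alpha> f + lshift x \<alpha> g"
  "rshift x \<alpha> (\<lambda>\<beta>. f' \<beta> + g' \<beta>) = rshift x \<alpha> f' + rshift x \<alpha> g'"
proof (induction \<alpha> arbitrary: f g f' g' rule: bits_snoc_induct)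
  case (snoc0 \<alpha>)
  { case 1 show ?case by (simp add: snoc0 algebra_simps)
  next
    case 2 show ?case by (simp add: snoc0) }
qed (simp_all add: algebra_simps)

lemma shift_mult:
  "lshift x \<alpha> (\<lambda>\<beta>. c * f \<beta>) = c * lshift x \<alpha> f"
  "rshift x \<alpha> (\<lambda>\<beta>. c * f' \<beta>) = c * rshift x \<alpha> f'"
proof (induction \<alpha> arbitrary: f f' rule: bits_snoc_induct)
  case (snoc0 \<alpha>)
  { case 1 show ?case
      by (simp add: snoc0(1) shift_add) (simp add: algebra_simps snoc0(1))
  next
    case 2 show ?case by (simp add: snoc0) }
qed (simp_all add: algebra_simps)

text \<open>
  At a final 0 the left functional composed with its counterpart for \<open>- x\<close> picks up the terms
  \<open>x l\<^sub>\<beta>\<close> and \<open>- x l\<^sub>\<beta>\<close>, which cancel by linearity; every other step only relabels entries.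
\<close>

lemma shift_inverse:
  fixes x :: "'f::field"
  shows "lshift x \<alpha> (\<lambda>\<beta>. case \<beta> of None \<Rightarrow> f None | Some \<gamma> \<Rightarrow> lshift (- x) \<gamma> f) = f (Some \<alpha>)"
    and "rshift x \<alpha> (\<lambda>\<beta>. rshift (- x) \<beta> g) = g \<alpha>"
proof (induction \<alpha> arbitrary: f g rule: bits_snoc_induct)
  case (snoc0 \<alpha>)
  { case 1
    have "lshift (- x) (append0 \<beta>) f + x * (case \<beta> of None \<Rightarrow> f None | Some \<gamma> \<Rightarrow> lshift (- x) \<gamma> f) =
        (case \<beta> of None \<Rightarrow> f (Some (append0 None))
          | Some \<gamma> \<Rightarrow> lshift (- x) \<gamma> (\<lambda>\<beta>. f (Some (append0 \<beta>))))" for \<beta>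
      by (cases \<beta>) (simp_all add: shift_add shift_mult del: mult_minus_left, simp_all)
    then show ?case
      using snoc0(1)[of "\<lambda>\<beta>. f (Some (append0 \<beta>))"] by simp
  next
    case 2
    have "rshift (- x) (append0 \<beta>) g =
        (case \<beta> of None \<Rightarrow> g (append0 None) | Some \<gamma> \<Rightarrow> lshift (- x) \<gamma> (\<lambda>\<beta>. g (append0 \<beta>)))" for \<beta>
      by (cases \<beta>) simp_all
    then show ?case
      using snoc0(1)[of "\<lambda>\<beta>. g (append0 \<beta>)"] by simp }
qed simp_all

text \<open>
  The indices whose entries the two functionals read. Everything the right functional reads is also
  read by the left one.
\<close>

inductive lterm :: "bits \<Rightarrow> bits option \<Rightarrow> bool"
  and rterm :: "bits \<Rightarrow> bits \<Rightarrow> bool" where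
  rterm_Nil: "rterm [] []"
| lterm_None: "lterm [] None"
| lterm_rterm: "rterm \<alpha> \<beta> \<Longrightarrow> lterm \<alpha> (Some \<beta>)"
| rterm_snoc1: "rterm \<alpha> \<beta> \<Longrightarrow> rterm (\<alpha> @ [True]) (\<beta> @ [True])"
| rterm_append0: "lterm \<alpha> \<beta> \<Longrightarrow> rterm (\<alpha> @ [False]) (append0 \<beta>)"
| lterm_drop0: "lterm \<alpha> \<beta> \<Longrightarrow> lterm (\<alpha> @ [False]) \<beta>"

lemma shift_cong:
  "(\<And>\<beta>. lterm \<alpha> \<beta> \<Longrightarrow> f \<beta> = g \<beta>) \<Longrightarrow> lshift x \<alpha> f = lshift x \<alpha> g"
  "(\<And>\<beta>. rterm \<alpha> \<beta> \<Longrightarrow> f' \<beta> = g' \<beta>) \<Longrightarrow> rshift x \<alpha> f' = rshift x \<alpha> g'"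
proof (induction \<alpha> arbitrary: f g f' g' rule: bits_snoc_induct)
  case Nil
  { case 1 show ?case by (simp add: 1 lterm_rterm.intros)
  next
    case 2 show ?case by (simp add: 2 lterm_rterm.intros) }
next
  case (snoc0 \<alpha>)
  { case 1
    have "f (Some (append0 \<beta>)) = g (Some (append0 \<beta>))" "f \<beta> = g \<beta>" if "lterm \<alpha> \<beta>" for \<beta>
      by (rule 1, intro lterm_rterm.intros that)+
    then show ?case
      unfolding lshift_simps by (intro snoc0(1)) simp
  next
    case 2
    have "f' (append0 \<beta>) = g' (append0 \<beta>)" if "lterm \<alpha> \<beta>" for \<beta>
      by (rule 2, intro lterm_rterm.intros that)
    then show ?case
      unfolding rshift_simps by (intro snoc0(1)) simp }
next
  case (snoc1 \<alpha>)
  { case 1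
    have "f (Some (\<beta> @ [True])) = g (Some (\<beta> @ [True]))" if "rterm \<alpha> \<beta>" for \<beta>
      by (rule 1, intro lterm_rterm.intros that)
    then show ?case
      unfolding lshift_simps by (intro snoc1(2)) simp
  next
    case 2
    have "f' (\<beta> @ [True]) = g' (\<beta> @ [True])" if "rterm \<alpha> \<beta>" for \<beta>
      by (rule 2, intro lterm_rterm.intros that)
    then show ?case
      unfolding rshift_simps by (intro snoc1(2)) simp }
qed

lemma del_step_append: "del_step a u v \<Longrightarrow> del_step a (u @ w) (v @ w)"
proof (induction rule: del_step.induct)
  case (del_first u)
  then show ?case using del_step.del_first[of a "u @ w"] by simp
next
  case (del_double u v)
  then show ?case using del_step.del_double[of a u "v @ w"] by simp
qed

lemma del_steps_append: "(del_step a)\<^sup>*\<^sup>* u v \<Longrightarrow> (del_step a)\<^sup>*\<^sup>* (u @ w) (v @ w)"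
  by (induction rule: rtranclp_induct) (auto intro: rtranclp.rtrancl_into_rtrancl del_step_append)

text \<open>
  For the left functional the induction needs the form with a 0 appended to both sides: an index
  read at \<open>\<alpha>\<close> need not be reachable from \<open>\<alpha>\<close> itself. It may be the extra index, and
  at \<open>10\<close> it may be \<open>1\<close>, which no deletion of 0 produces from \<open>10\<close>. After appending 0, dropping
  the last 0 of \<open>\<alpha>\<close> becomes the replacement of \<open>00\<close> by \<open>0\<close>.
\<close>

lemma term_reachable:
  "lterm \<alpha> \<beta> \<Longrightarrow> (del_step False)\<^sup>*\<^sup>* (\<alpha> @ [False]) (append0 \<beta>)"
  "rterm \<alpha> \<gamma> \<Longrightarrow> (del_step False)\<^sup>*\<^sup>* \<alpha> \<gamma>"
proof (induction rule: lterm_rterm.inducts)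
  case lterm_None
  then show ?case using del_step.del_first[of False "[]"] by auto
next
  case (lterm_drop0 \<alpha> \<beta>)
  have "del_step False ((\<alpha> @ [False]) @ [False]) (\<alpha> @ [False])"
    using del_step.del_double[of False \<alpha> "[]"] by simp
  then show ?case
    using lterm_drop0.IH by (rule converse_rtranclp_into_rtranclp)
next
  case (lterm_rterm \<alpha> \<beta>)
  then show ?case by (simp add: del_steps_append)
qed (simp_all add: del_steps_append)

definition translate_L :: "bits set \<Rightarrow> 'f::field \<Rightarrow> 'f vec \<Rightarrow> 'f vec" where
  "translate_L \<Omega> x l =
     (\<lambda>i\<in>indices \<Omega>. case i of None \<Rightarrow> l None | Some w \<Rightarrow> lshift x w l)"

definition translate_R :: "bits set \<Rightarrow> 'f::field \<Rightarrow> 'f vec \<Rightarrow> 'f vec" where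
  "translate_R \<Omega> x r =
     (\<lambda>i\<in>indices \<Omega>. case i of None \<Rightarrow> r None + x | Some w \<Rightarrow> rshift x w (\<lambda>\<beta>. r (Some \<beta>)))"

lemma translate_simps [simp]:
  "translate_L \<Omega> x l None = l None"
  "w \<in> \<Omega> \<Longrightarrow> translate_L \<Omega> x l (Some w) = lshift x w l"
  "translate_R \<Omega> x r None = r None + x"
  "w \<in> \<Omega> \<Longrightarrow> translate_R \<Omega> x r (Some w) = rshift x w (\<lambda>\<beta>. r (Some \<beta>))"
  by (simp_all add: translate_L_def translate_R_def)

lemma translate_mem_vectors [simp]:
  "translate_L \<Omega> x l \<in> vectors \<Omega>" "translate_R \<Omega> x r \<in> vectors \<Omega>"
  by (simp_all add: translate_L_def translate_R_def)

lemma cond_C1_butlast: "cond_C1 \<Omega> \<Longrightarrow> \<alpha> @ [b] \<in> \<Omega> \<Longrightarrow> \<alpha> \<in> \<Omega>"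
  unfolding cond_C1_def by (metis DiffI butlast_snoc singletonD snoc_eq_iff_butlast)

locale translation =
  fixes \<Omega> :: "bits set"
  assumes C1: "cond_C1 \<Omega>" and H0: "H_set False \<Omega> \<subseteq> \<Omega>"
begin

lemma rterm_mem: "rterm \<alpha> \<beta> \<Longrightarrow> \<alpha> \<in> \<Omega> \<Longrightarrow> \<beta> \<in> \<Omega>"
  using H0 term_reachable(2) by (auto simp: H_set_def)

lemma append0_mem: "lterm \<alpha> \<beta> \<Longrightarrow> \<alpha> @ [False] \<in> \<Omega> \<Longrightarrow> append0 \<beta> \<in> \<Omega>"
  using H0 term_reachable(1) by (auto simp: H_set_def)

lemma lterm_mem: "lterm \<alpha> \<beta> \<Longrightarrow> \<alpha> \<in> \<Omega> \<Longrightarrow> \<beta> \<in> indices \<Omega>"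
  and "rterm \<alpha> \<gamma> \<Longrightarrow> \<alpha> \<in> \<Omega> \<Longrightarrow> \<gamma> \<in> \<Omega>"
proof (induction rule: lterm_rterm.inducts)
  case (rterm_snoc1 \<alpha> \<beta>)
  then show ?case using rterm_mem lterm_rterm.rterm_snoc1 by blast
next
  case (rterm_append0 \<alpha> \<beta>)
  then show ?case using append0_mem by blast
next
  case (lterm_drop0 \<alpha> \<beta>)
  then show ?case using cond_C1_butlast[OF C1] by blast
qed simp_all

lemma translate_L_inverse:
  assumes "l \<in> vectors \<Omega>"
  shows "translate_L \<Omega> x (translate_L \<Omega> (- x) l) = l"
proof (rule vectors_eqI)
  fix w assume w: "w \<in> \<Omega>"
  have "lshift x w (translate_L \<Omega> (- x) l)
      = lshift x w (\<lambda>\<beta>. case \<beta> of None \<Rightarrow> l None | Some \<gamma> \<Rightarrow> lshift (- x) \<gamma> l)"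
  proof (rule shift_cong(1))
    fix \<beta> assume "lterm w \<beta>"
    from lterm_mem[OF this w] show "translate_L \<Omega> (- x) l \<beta> =
        (case \<beta> of None \<Rightarrow> l None | Some \<gamma> \<Rightarrow> lshift (- x) \<gamma> l)"
      by (cases \<beta>) simp_all
  qed
  then show "translate_L \<Omega> x (translate_L \<Omega> (- x) l) (Some w) = l (Some w)"
    using w by (simp add: shift_inverse(1))
qed (use assms in simp_all)

lemma translate_R_inverse:
  assumes "r \<in> vectors \<Omega>"
  shows "translate_R \<Omega> x (translate_R \<Omega> (- x) r) = r"
proof (rule vectors_eqI)
  fix w assume w: "w \<in> \<Omega>"
  have "rshift x w (\<lambda>\<beta>. translate_R \<Omega> (- x) r (Some \<beta>))
      = rshift x w (\<lambda>\<beta>. rshift (- x) \<beta> (\<lambda>\<gamma>. r (Some \<gamma>)))"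
    using w rterm_mem by (intro shift_cong(2)) simp
  then show "translate_R \<Omega> x (translate_R \<Omega> (- x) r) (Some w) = r (Some w)"
    using w by (simp add: shift_inverse(2))
qed (use assms in simp_all)

lemma translate_incident:
  assumes inc: "incident \<Omega> l r"
  shows "incident \<Omega> (translate_L \<Omega> x l) (translate_R \<Omega> x r)"
  unfolding incident_def
proof (intro conjI allI impI)
  have nil: "[] \<in> \<Omega>" and eq: "l (Some []) + r (Some []) = l None * r None"
    using C1 inc by (auto simp: cond_C1_def incident_def)
  show "translate_L \<Omega> x l (Some []) + translate_R \<Omega> x r (Some [])
      = translate_L \<Omega> x l None * translate_R \<Omega> x r None"
    using nil eq by (simp add: algebra_simps)
next
  fix \<alpha> assume w: "\<alpha> @ [False] \<in> \<Omega>"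
  have "lshift x (\<alpha> @ [False]) l + rshift x (\<alpha> @ [False]) (\<lambda>\<beta>. r (Some \<beta>))
      = lshift x \<alpha> (\<lambda>\<beta>. l (Some (append0 \<beta>)) + x * l \<beta> + r (Some (append0 \<beta>)))"
    by (simp add: shift_add)
  also have "\<dots> = lshift x \<alpha> (\<lambda>\<beta>. (r None + x) * l \<beta>)"
  proof (rule shift_cong(1))
    fix \<beta> assume "lterm \<alpha> \<beta>"
    then have "append0 \<beta> \<in> \<Omega>" using append0_mem w by blast
    then have "l (Some (append0 \<beta>)) + r (Some (append0 \<beta>)) = r None * l \<beta>"
      using inc by (cases \<beta>) (simp_all add: incident_def mult.commute)
    then show "l (Some (append0 \<beta>)) + x * l \<beta> + r (Some (append0 \<beta>)) = (r None + x) * l \<beta>"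
      by (simp add: algebra_simps)
  qed
  also have "\<dots> = (r None + x) * lshift x \<alpha> l"
    by (rule shift_mult(1))
  finally show "translate_L \<Omega> x l (Some (\<alpha> @ [False])) + translate_R \<Omega> x r (Some (\<alpha> @ [False]))
      = translate_R \<Omega> x r None * translate_L \<Omega> x l (Some \<alpha>)"
    using w cond_C1_butlast[OF C1 w] by simp
next
  fix \<alpha> assume w: "\<alpha> @ [True] \<in> \<Omega>"
  have "lshift x (\<alpha> @ [True]) l + rshift x (\<alpha> @ [True]) (\<lambda>\<beta>. r (Some \<beta>))
      = rshift x \<alpha> (\<lambda>\<beta>. l (Some (\<beta> @ [True])) + r (Some (\<beta> @ [True])))"
    by (simp add: shift_add)
  also have "\<dots> = rshift x \<alpha> (\<lambda>\<beta>. l None * r (Some \<beta>))"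
    using inc rterm_mem[OF rterm_snoc1 w] by (intro shift_cong(2)) (simp add: incident_def)
  also have "\<dots> = l None * rshift x \<alpha> (\<lambda>\<beta>. r (Some \<beta>))"
    by (rule shift_mult(2))
  finally show "translate_L \<Omega> x l (Some (\<alpha> @ [True])) + translate_R \<Omega> x r (Some (\<alpha> @ [True]))
      = translate_L \<Omega> x l None * translate_R \<Omega> x r (Some \<alpha>)"
    using w cond_C1_butlast[OF C1 w] by simp
qed

lemma translate_automorphism:
  fixes x :: "'f::{field,finite}"
  assumes "finite \<Omega>"
  shows "graph_automorphism (Gamma \<Omega>) (side_map (translate_L \<Omega> x) (translate_R \<Omega> x))"
proof (rule side_map_automorphism[OF assms])
  show "inj_on (translate_L \<Omega> x) (vectors \<Omega>)"
    using translate_L_inverse[of _ "- x"] by (intro inj_on_inverseI[of _ "translate_L \<Omega> (- x)"]) simp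
  show "inj_on (translate_R \<Omega> x) (vectors \<Omega>)"
    using translate_R_inverse[of _ "- x"] by (intro inj_on_inverseI[of _ "translate_R \<Omega> (- x)"]) simp
qed (simp_all add: translate_incident)

end

section \<open>Translating the entry at a binary sequence\<close>

text \<open>
  What has to be added to the left and right entries at \<open>\<alpha>s\<close>, as a function of the suffix \<open>s\<close>, when
  \<open>c\<close> is added to the right entry at \<open>\<alpha>\<close>. The entry added at \<open>\<alpha>1\<close> on the left and the one
  at \<open>\<alpha>0\<close> on the right absorb the first errors; the errors of the next step are multiples of
  \<open>l\<^sub>* r\<^sub>*\<close> and are expressed through the equation at the null sequence.
\<close>

fun kick_L :: "'f::field \<Rightarrow> 'f vec \<Rightarrow> bits \<Rightarrow> 'f" where
  "kick_L c l [] = - c"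
| "kick_L c l [True] = c * l None"
| "kick_L c l (False # True # \<beta>) = - c * l (Some \<beta>)"
| "kick_L c l (True # False # \<beta>) = c * l (Some \<beta>)"
| "kick_L c l _ = 0"

fun kick_R :: "'f::field \<Rightarrow> 'f vec \<Rightarrow> bits \<Rightarrow> 'f" where
  "kick_R c r [] = c"
| "kick_R c r [False] = - c * r None"
| "kick_R c r (False # True # \<beta>) = - c * r (Some \<beta>)"
| "kick_R c r (True # False # \<beta>) = c * r (Some \<beta>)"
| "kick_R c r _ = 0"

definition at_extension :: "bits \<Rightarrow> (bits \<Rightarrow> 'f::zero) \<Rightarrow> bits \<Rightarrow> 'f" where
  "at_extension \<alpha> k w = (if prefix \<alpha> w then k (drop (length \<alpha>) w) else 0)"

definition kick :: "bits set \<Rightarrow> bits \<Rightarrow> ('f::field vec \<Rightarrow> bits \<Rightarrow> 'f) \<Rightarrow> 'f vec \<Rightarrow> 'f vec" where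
  "kick \<Omega> \<alpha> k v =
     (\<lambda>i\<in>indices \<Omega>. case i of None \<Rightarrow> v None | Some w \<Rightarrow> v (Some w) + at_extension \<alpha> (k v) w)"

lemma at_extension_append [simp]: "at_extension \<alpha> k (\<alpha> @ s) = k s"
  by (simp add: at_extension_def)

lemma at_extension_self [simp]: "at_extension \<alpha> k \<alpha> = k []"
  by (simp add: at_extension_def)

lemma at_extension_not_prefix [simp]: "\<not> prefix \<alpha> w \<Longrightarrow> at_extension \<alpha> k w = 0"
  by (simp add: at_extension_def)

lemma kick_simps [simp]:
  "kick \<Omega> \<alpha> k v None = v None"
  "w \<in> \<Omega> \<Longrightarrow> kick \<Omega> \<alpha> k v (Some w) = v (Some w) + at_extension \<alpha> (k v) w"
  by (simp_all add: kick_def)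

lemma kick_mem_vectors [simp]: "kick \<Omega> \<alpha> k v \<in> vectors \<Omega>"
  by (simp add: kick_def)

lemma kick_cong:
  assumes "l None = m None"
    and "\<And>\<beta>. s = False # True # \<beta> \<or> s = True # False # \<beta> \<Longrightarrow> l (Some \<beta>) = m (Some \<beta>)"
  shows "kick_L c l s = kick_L c m s" and "kick_R c l s = kick_R c m s"
proof -
  show "kick_L c l s = kick_L c m s"
    using assms by (cases "(c, l, s)" rule: kick_L.cases) simp_all
  show "kick_R c l s = kick_R c m s"
    using assms by (cases "(c, l, s)" rule: kick_R.cases) simp_all
qed

text \<open>
  As \<open>l\<^sub>*\<close> and \<open>r\<^sub>*\<close> stay fixed, the equations at \<open>\<alpha>0\<close> and \<open>\<alpha>1\<close> are linear, so the added
  entries have to satisfy them by themselves. Only the following cases use the given incidence: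
  at \<open>s = 1\<close> it is the equation at the null sequence, times \<open>c\<close>, and at \<open>s = 01\<beta>\<close> or
  \<open>s = 10\<beta>\<close> it is the equation at \<open>\<beta>0\<close>, times \<open>- c\<close> or \<open>c\<close>.
\<close>

lemma kick_snoc0:
  assumes "l (Some []) + r (Some []) = l None * r None"
    and "\<And>\<beta>. s = False # True # \<beta> \<or> s = True # False # \<beta> \<Longrightarrow>
      l (Some (\<beta> @ [False])) + r (Some (\<beta> @ [False])) = r None * l (Some \<beta>)"
  shows "kick_L c l (s @ [False]) + kick_R c r (s @ [False]) = r None * kick_L c l s"
proof -
  have "c * l (Some []) + c * r (Some []) = c * (l None * r None)"
    by (simp only: assms(1) flip: distrib_left)
  moreover have "c * l (Some (\<beta> @ [False])) + c * r (Some (\<beta> @ [False])) = c * (r None * l (Some \<beta>))"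
    if "s = False # True # \<beta> \<or> s = True # False # \<beta>" for \<beta>
    by (simp only: assms(2)[OF that] flip: distrib_left)
  ultimately show ?thesis
    by (cases "(c, l, s)" rule: kick_L.cases) (simp_all add: algebra_simps)
qed

lemma kick_snoc1:
  assumes "l (Some []) + r (Some []) = l None * r None"
    and "\<And>\<beta>. s = False # True # \<beta> \<or> s = True # False # \<beta> \<Longrightarrow>
      l (Some (\<beta> @ [True])) + r (Some (\<beta> @ [True])) = l None * r (Some \<beta>)"
  shows "kick_L c l (s @ [True]) + kick_R c r (s @ [True]) = l None * kick_R c r s"
proof -
  have "c * l (Some []) + c * r (Some []) = c * (l None * r None)"
    by (simp only: assms(1) flip: distrib_left)
  moreover have "c * l (Some (\<beta> @ [True])) + c * r (Some (\<beta> @ [True])) = c * (l None * r (Some \<beta>))"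
    if "s = False # True # \<beta> \<or> s = True # False # \<beta>" for \<beta>
    by (simp only: assms(2)[OF that] flip: distrib_left)
  ultimately show ?thesis
    by (cases "(c, r, s)" rule: kick_R.cases) (simp_all add: algebra_simps)
qed

locale kicking =
  fixes \<Omega> :: "bits set" and \<alpha> :: bits
  assumes C1: "cond_C1 \<Omega>" and S: "S_all \<Omega> \<subseteq> \<Omega>" and mem: "\<alpha> \<in> \<Omega>"
begin

lemma tail_mem:
  assumes "\<alpha> @ False # True # \<beta> \<in> \<Omega> \<or> \<alpha> @ True # False # \<beta> \<in> \<Omega>"
  shows "\<beta> \<in> \<Omega>"
proof -
  have "\<beta> \<in> S_at \<Omega> \<alpha>"
    using assms by (auto simp: S_at_def)
  then show ?thesis
    using S mem by (auto simp: S_all_def)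
qed

text \<open>
  Kicking by \<open>- c\<close> does not undo kicking by \<open>c\<close>, because \<open>\<beta>\<close> may itself be an extension of \<open>\<alpha>\<close>.
  But what is added at \<open>\<alpha>01\<beta>\<close> or \<open>\<alpha>10\<beta>\<close> is determined by an entry at a shorter sequence, so
  the old entries can be recovered one length after another.
\<close>

lemma inj_on_kick:
  fixes k :: "'f::field vec \<Rightarrow> bits \<Rightarrow> 'f"
  assumes k: "\<And>l m s. \<lbrakk>l None = m None;
      \<And>\<beta>. s = False # True # \<beta> \<or> s = True # False # \<beta> \<Longrightarrow> l (Some \<beta>) = m (Some \<beta>)\<rbrakk> \<Longrightarrow> k l s = k m s"
  shows "inj_on (kick \<Omega> \<alpha> k) (vectors \<Omega>)"
proof (rule inj_onI)
  fix l m assume lm: "l \<in> vectors \<Omega>" "m \<in> vectors \<Omega>" and eq: "kick \<Omega> \<alpha> k l = kick \<Omega> \<alpha> k m"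
  have none: "l None = m None"
    using fun_cong[OF eq, of None] by simp
  have "l (Some w) = m (Some w)" if "w \<in> \<Omega>" for w
    using that
  proof (induction w rule: length_induct)
    case (1 w)
    have "at_extension \<alpha> (k l) w = at_extension \<alpha> (k m) w"
    proof (cases "prefix \<alpha> w")
      case True
      then obtain s where w: "w = \<alpha> @ s" by (auto elim: prefixE)
      have "k l s = k m s"
      proof (rule k)
        show "l None = m None" by (rule none)
        fix \<beta> assume "s = False # True # \<beta> \<or> s = True # False # \<beta>"
        then have "\<beta> \<in> \<Omega>" and "length \<beta> < length w"
          using tail_mem[of \<beta>] 1(2) w by auto
        then show "l (Some \<beta>) = m (Some \<beta>)"
          using 1(1) by blast
      qed
      then show ?thesis by (simp add: w)
    qed simp
    then show ?case
      using fun_cong[OF eq, of "Some w"] 1(2) by simp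
  qed
  with lm none show "l = m" by (intro vectors_eqI)
qed

lemma kick_incident:
  assumes inc: "incident \<Omega> l r"
  shows "incident \<Omega> (kick \<Omega> \<alpha> (kick_L c) l) (kick \<Omega> \<alpha> (kick_R c) r)"
proof -
  have nil: "[] \<in> \<Omega>"
    using C1 by (simp add: cond_C1_def)
  have eq: "l (Some []) + r (Some []) = l None * r None"
      "\<And>w. w @ [False] \<in> \<Omega> \<Longrightarrow> l (Some (w @ [False])) + r (Some (w @ [False])) = r None * l (Some w)"
      "\<And>w. w @ [True] \<in> \<Omega> \<Longrightarrow> l (Some (w @ [True])) + r (Some (w @ [True])) = l None * r (Some w)"
    using inc by (auto simp: incident_def)
  \<comment> \<open>This is where \<open>c\<close> on the right and \<open>- c\<close> on the left cancel; the right-hand side of the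
    equation at \<open>\<alpha>\<close> involves only unchanged entries.\<close>
  have self: "at_extension \<alpha> (kick_L c l) w + at_extension \<alpha> (kick_R c r) w = 0"
    if "w = \<alpha> \<or> \<not> prefix \<alpha> w" for w
    using that by auto
  have at_nil: "at_extension \<alpha> (kick_L c l) [] + at_extension \<alpha> (kick_R c r) [] = 0"
    by (rule self) auto
  have snoc0: "at_extension \<alpha> (kick_L c l) (w @ [False]) + at_extension \<alpha> (kick_R c r) (w @ [False])
      = r None * at_extension \<alpha> (kick_L c l) w" if w: "w @ [False] \<in> \<Omega>" for w
  proof (cases "prefix \<alpha> w")
    case True
    then obtain s where s: "w = \<alpha> @ s" by (auto elim: prefixE)
    have "kick_L c l (s @ [False]) + kick_R c r (s @ [False]) = r None * kick_L c l s"
    proof (rule kick_snoc0[OF eq(1)])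
      fix \<beta> assume "s = False # True # \<beta> \<or> s = True # False # \<beta>"
      then have "\<beta> @ [False] \<in> \<Omega>"
        using tail_mem[of "\<beta> @ [False]"] w s by auto
      then show "l (Some (\<beta> @ [False])) + r (Some (\<beta> @ [False])) = r None * l (Some \<beta>)"
        by (rule eq(2))
    qed
    then show ?thesis by (simp add: s)
  qed (use self[of "w @ [False]"] in auto)
  have snoc1: "at_extension \<alpha> (kick_L c l) (w @ [True]) + at_extension \<alpha> (kick_R c r) (w @ [True])
      = l None * at_extension \<alpha> (kick_R c r) w" if w: "w @ [True] \<in> \<Omega>" for w
  proof (cases "prefix \<alpha> w")
    case True
    then obtain s where s: "w = \<alpha> @ s" by (auto elim: prefixE)
    have "kick_L c l (s @ [True]) + kick_R c r (s @ [True]) = l None * kick_R c r s"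
    proof (rule kick_snoc1[OF eq(1)])
      fix \<beta> assume "s = False # True # \<beta> \<or> s = True # False # \<beta>"
      then have "\<beta> @ [True] \<in> \<Omega>"
        using tail_mem[of "\<beta> @ [True]"] w s by auto
      then show "l (Some (\<beta> @ [True])) + r (Some (\<beta> @ [True])) = l None * r (Some \<beta>)"
        by (rule eq(3))
    qed
    then show ?thesis by (simp add: s)
  qed (use self[of "w @ [True]"] in auto)
  show ?thesis
    unfolding incident_def
  proof (intro conjI allI impI)
    show "kick \<Omega> \<alpha> (kick_L c) l (Some []) + kick \<Omega> \<alpha> (kick_R c) r (Some [])
        = kick \<Omega> \<alpha> (kick_L c) l None * kick \<Omega> \<alpha> (kick_R c) r None"
      using nil eq(1) at_nil by (simp add: algebra_simps)
  next
    fix w assume w: "w @ [False] \<in> \<Omega>"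
    show "kick \<Omega> \<alpha> (kick_L c) l (Some (w @ [False])) + kick \<Omega> \<alpha> (kick_R c) r (Some (w @ [False]))
        = kick \<Omega> \<alpha> (kick_R c) r None * kick \<Omega> \<alpha> (kick_L c) l (Some w)"
      using w cond_C1_butlast[OF C1 w] eq(2)[OF w] snoc0[OF w] by (simp add: algebra_simps)
  next
    fix w assume w: "w @ [True] \<in> \<Omega>"
    show "kick \<Omega> \<alpha> (kick_L c) l (Some (w @ [True])) + kick \<Omega> \<alpha> (kick_R c) r (Some (w @ [True]))
        = kick \<Omega> \<alpha> (kick_L c) l None * kick \<Omega> \<alpha> (kick_R c) r (Some w)"
      using w cond_C1_butlast[OF C1 w] eq(3)[OF w] snoc1[OF w] by (simp add: algebra_simps)
  qed
qed

lemma kick_automorphism: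
  fixes c :: "'f::{field,finite}"
  assumes "finite \<Omega>"
  shows "graph_automorphism (Gamma \<Omega>)
    (side_map (kick \<Omega> \<alpha> (kick_L c)) (kick \<Omega> \<alpha> (kick_R c)))"
  by (rule side_map_automorphism[OF assms])
    (simp_all add: kick_incident inj_on_kick[OF kick_cong(1)] inj_on_kick[OF kick_cong(2)])

end

section \<open>Moving every right vertex to zero\<close>

text \<open>
  The set \<open>T\<close> of entries not yet cleared is closed under extensions within \<open>\<Omega>\<close>. A kick at a
  shortest element of \<open>T\<close> then changes only entries in \<open>T\<close>, and removing that element keeps the
  closure: no other element of \<open>T\<close> is a prefix of it.
\<close>

lemma clear_right_vertex:
  fixes r :: "'f::{field,finite} vec"
  assumes fin: "finite \<Omega>" and C1: "cond_C1 \<Omega>" and S: "S_all \<Omega> \<subseteq> \<Omega>"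
  shows "\<lbrakk>T \<subseteq> \<Omega>; \<And>u v. u \<in> T \<Longrightarrow> u @ v \<in> \<Omega> \<Longrightarrow> u @ v \<in> T;
      r \<in> vectors \<Omega>; r None = 0; \<And>w. w \<in> \<Omega> - T \<Longrightarrow> r (Some w) = 0\<rbrakk>
    \<Longrightarrow> \<exists>\<pi>. graph_automorphism (Gamma \<Omega>) \<pi> \<and> \<pi> (Rvert r) = Rvert (zero_vector \<Omega>)"
proof (induction "card T" arbitrary: T r)
  case 0
  then have "T = {}" using finite_subset[OF _ fin, of T] by simp
  with 0 have "r = zero_vector \<Omega>"
    by (intro vectors_eqI) (auto simp: zero_vector_def)
  moreover have "graph_automorphism (Gamma \<Omega> :: 'f vertex graph) id"
    by (simp add: graph_automorphism_def)
  ultimately show ?case by (metis id_apply)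
next
  case (Suc n)
  have "T \<noteq> {}" using Suc.hyps(2) by auto
  then obtain \<alpha> where \<alpha>: "\<alpha> \<in> T" and min: "\<And>w. w \<in> T \<Longrightarrow> length \<alpha> \<le> length w"
    using ex_has_least_nat[of "\<lambda>w. w \<in> T" _ length] by blast
  interpret kicking \<Omega> \<alpha>
    using C1 S \<alpha> Suc.prems(1) by unfold_locales auto
  define \<rho> :: "'f vertex \<Rightarrow> 'f vertex" where
    "\<rho> = side_map (kick \<Omega> \<alpha> (kick_L (- r (Some \<alpha>)))) (kick \<Omega> \<alpha> (kick_R (- r (Some \<alpha>))))"
  define r' where "r' = kick \<Omega> \<alpha> (kick_R (- r (Some \<alpha>))) r"
  have \<rho>: "graph_automorphism (Gamma \<Omega>) \<rho>" "\<rho> (Rvert r) = Rvert r'"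
    by (simp_all add: \<rho>_def r'_def kick_automorphism[OF fin])
  have "\<exists>\<pi>. graph_automorphism (Gamma \<Omega>) \<pi> \<and> \<pi> (Rvert r') = Rvert (zero_vector \<Omega>)"
  proof (rule Suc.hyps(1)[of "T - {\<alpha>}"])
    show "n = card (T - {\<alpha>})"
      using Suc.hyps(2) \<alpha> by simp
    show "T - {\<alpha>} \<subseteq> \<Omega>"
      using Suc.prems(1) by blast
    show "u @ v \<in> T - {\<alpha>}" if "u \<in> T - {\<alpha>}" "u @ v \<in> \<Omega>" for u v
      using that Suc.prems(2)[of u v] min[of u] by (cases v) auto
    show "r' \<in> vectors \<Omega>" "r' None = 0"
      using Suc.prems(4) by (simp_all add: r'_def)
    show "r' (Some w) = 0" if w: "w \<in> \<Omega> - (T - {\<alpha>})" for w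
    proof (cases "w = \<alpha>")
      case True
      then show ?thesis
        using w by (simp add: r'_def)
    next
      case False
      then have "w \<in> \<Omega> - T" using w by blast
      moreover from this have "\<not> prefix \<alpha> w"
        using Suc.prems(2)[OF \<alpha>] by (auto elim!: prefixE)
      ultimately show ?thesis
        using Suc.prems(5) by (simp add: r'_def)
    qed
  qed
  then obtain \<pi> where \<pi>: "graph_automorphism (Gamma \<Omega>) \<pi>" "\<pi> (Rvert r') = Rvert (zero_vector \<Omega>)"
    by blast
  have "graph_automorphism (Gamma \<Omega>) (\<pi> \<circ> \<rho>)"
    using graph_automorphism_compose \<rho>(1) \<pi>(1) .
  moreover have "(\<pi> \<circ> \<rho>) (Rvert r) = Rvert (zero_vector \<Omega>)"
    using \<rho>(2) \<pi>(2) by simp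
  ultimately show ?case by blast
qed

proposition right_vertex_to_zero:
  assumes fin: "finite \<Omega>" and C1: "cond_C1 \<Omega>" and S: "S_all \<Omega> \<subseteq> \<Omega>" and H0: "H_set False \<Omega> \<subseteq> \<Omega>"
    and v: "v \<in> (R_verts \<Omega> :: 'f::{field,finite} vertex set)"
  shows "\<exists>\<pi>. graph_automorphism (Gamma \<Omega>) \<pi> \<and> \<pi> v = Rvert (zero_vector \<Omega>)"
proof -
  obtain r where r: "v = Rvert r" "r \<in> vectors \<Omega>"
    using v by (auto simp: R_verts_def)
  interpret translation \<Omega>
    using C1 H0 by unfold_locales
  define \<rho> :: "'f vertex \<Rightarrow> 'f vertex" where
    "\<rho> = side_map (translate_L \<Omega> (- r None)) (translate_R \<Omega> (- r None))"
  define r' where "r' = translate_R \<Omega> (- r None) r"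
  have \<rho>: "graph_automorphism (Gamma \<Omega>) \<rho>" "\<rho> v = Rvert r'"
    by (simp_all add: \<rho>_def r'_def r(1) translate_automorphism[OF fin])
  obtain \<pi> where \<pi>: "graph_automorphism (Gamma \<Omega>) \<pi>" "\<pi> (Rvert r') = Rvert (zero_vector \<Omega>)"
    using clear_right_vertex[OF fin C1 S, of \<Omega> r'] by (auto simp: r'_def)
  have "graph_automorphism (Gamma \<Omega>) (\<pi> \<circ> \<rho>)"
    using graph_automorphism_compose \<rho>(1) \<pi>(1) .
  moreover have "(\<pi> \<circ> \<rho>) v = Rvert (zero_vector \<Omega>)"
    using \<rho>(2) \<pi>(2) by simp
  ultimately show ?thesis by blast
qed

section \<open>Duality\<close>

text \<open>
  Complementing bits exchanges the two kinds of recursive equations, up to exchanging the sides.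
  The exchange of sides is an involution of all vertices, so conjugation by it carries automorphisms
  of the graph of the complemented index set to automorphisms of the original one.
\<close>

abbreviation complement :: "bits \<Rightarrow> bits" where
  "complement \<equiv> map Not"

lemma Not_comp_Not [simp]: "Not \<circ> Not = id"
  by (simp add: fun_eq_iff)

lemma complement_complement: "complement (complement w) = w"
  by simp

lemma mem_complement_image_iff: "w \<in> complement ` \<Omega> \<longleftrightarrow> complement w \<in> \<Omega>"
  by (metis complement_complement image_iff)

definition dual_vec :: "'f vec \<Rightarrow> 'f vec" where
  "dual_vec l = l \<circ> map_option complement"

fun dual_vertex :: "'f vertex \<Rightarrow> 'f vertex" where
  "dual_vertex (Lvert l) = Rvert (dual_vec l)"
| "dual_vertex (Rvert r) = Lvert (dual_vec r)"

lemma dual_vec_simps [simp]: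
  "dual_vec l None = l None" "dual_vec l (Some w) = l (Some (complement w))"
  by (simp_all add: dual_vec_def)

lemma dual_vec_dual_vec [simp]: "dual_vec (dual_vec l) = l"
proof
  show "dual_vec (dual_vec l) i = l i" for i by (cases i) simp_all
qed

lemma dual_vertex_dual_vertex [simp]: "dual_vertex (dual_vertex v) = v"
  by (cases v) simp_all

lemma dual_zero_vector: "dual_vec (zero_vector (complement ` \<Omega>)) = zero_vector \<Omega>"
proof
  show "dual_vec (zero_vector (complement ` \<Omega>)) i = zero_vector \<Omega> i" for i
    by (cases i) (simp_all add: zero_vector_def mem_complement_image_iff)
qed

lemma dual_vec_mem_iff: "dual_vec l \<in> vectors (complement ` \<Omega>) \<longleftrightarrow> l \<in> vectors \<Omega>"
proof -
  have "(\<forall>i. i \<notin> indices (complement ` \<Omega>) \<longrightarrow> dual_vec l i = undefined) \<longleftrightarrow>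
      (\<forall>w. complement w \<notin> \<Omega> \<longrightarrow> l (Some (complement w)) = undefined)"
    by (auto simp: split_option_all mem_complement_image_iff)
  also have "\<dots> \<longleftrightarrow> (\<forall>w. w \<notin> \<Omega> \<longrightarrow> l (Some w) = undefined)"
    by (metis complement_complement)
  also have "\<dots> \<longleftrightarrow> (\<forall>i. i \<notin> indices \<Omega> \<longrightarrow> l i = undefined)"
    by (auto simp: split_option_all)
  finally show ?thesis
    by (auto simp: vectors_def PiE_def extensional_def)
qed

lemma incident_dual: "incident (complement ` \<Omega>) (dual_vec r) (dual_vec l) \<longleftrightarrow> incident \<Omega> l r"
proof -
  have all: "(\<forall>\<alpha>. P (complement \<alpha>)) \<longleftrightarrow> (\<forall>\<alpha>. P \<alpha>)" for P
    by (metis complement_complement)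
  show ?thesis
    using all[of "\<lambda>\<alpha>. \<alpha> @ [True] \<in> \<Omega> \<longrightarrow>
        l (Some (\<alpha> @ [True])) + r (Some (\<alpha> @ [True])) = l None * r (Some \<alpha>)"]
      all[of "\<lambda>\<alpha>. \<alpha> @ [False] \<in> \<Omega> \<longrightarrow>
        l (Some (\<alpha> @ [False])) + r (Some (\<alpha> @ [False])) = r None * l (Some \<alpha>)"]
    by (auto simp: incident_def mem_complement_image_iff add.commute mult.commute)
qed

lemma dual_vertex_mem_iff:
  "dual_vertex v \<in> fst (Gamma (complement ` \<Omega>)) \<longleftrightarrow> v \<in> fst (Gamma \<Omega>)"
  by (cases v) (auto simp: fst_Gamma L_verts_def R_verts_def dual_vec_mem_iff)

lemma dual_edge_iff:
  "{dual_vertex u, dual_vertex v} \<in> snd (Gamma (complement ` \<Omega>)) \<longleftrightarrow> {u, v} \<in> snd (Gamma \<Omega>)"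
proof -
  have same: "{Lvert l, Lvert m} \<notin> snd (Gamma A)" "{Rvert l, Rvert m} \<notin> snd (Gamma A)"
    for l m :: "'a vec" and A
    by (auto simp: Gamma_def doubleton_eq_iff)
  show ?thesis
    by (cases u; cases v)
      (auto simp: same Lvert_Rvert_edge_iff Rvert_Lvert_edge_iff dual_vec_mem_iff incident_dual)
qed

lemma graph_automorphism_dual:
  assumes "graph_automorphism (Gamma (complement ` \<Omega>)) \<pi>"
  shows "graph_automorphism (Gamma \<Omega>) (dual_vertex \<circ> \<pi> \<circ> dual_vertex)"
proof -
  let ?V = "fst (Gamma \<Omega>)" and ?V' = "fst (Gamma (complement ` \<Omega>))"
  have bij: "bij_betw \<pi> ?V' ?V'" and edges: "\<And>u v. u \<in> ?V' \<Longrightarrow> v \<in> ?V' \<Longrightarrow>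
      {u, v} \<in> snd (Gamma (complement ` \<Omega>)) \<longleftrightarrow> {\<pi> u, \<pi> v} \<in> snd (Gamma (complement ` \<Omega>))"
    using assms by (auto simp: graph_automorphism_def)
  have to: "bij_betw dual_vertex ?V ?V'"
    by (rule bij_betw_byWitness[of _ dual_vertex]) (use dual_vertex_mem_iff in \<open>force+\<close>)
  have from': "bij_betw dual_vertex ?V' ?V"
    by (rule bij_betw_byWitness[of _ dual_vertex]) (use dual_vertex_mem_iff in \<open>force+\<close>)
  have edge_iff: "{u, v} \<in> snd (Gamma \<Omega>) \<longleftrightarrow>
      {dual_vertex (\<pi> (dual_vertex u)), dual_vertex (\<pi> (dual_vertex v))} \<in> snd (Gamma \<Omega>)"
    if uv: "u \<in> ?V" "v \<in> ?V" for u v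
    using edges[of "dual_vertex u" "dual_vertex v"] uv
      dual_edge_iff[of u v \<Omega>]
      dual_edge_iff[of "dual_vertex (\<pi> (dual_vertex u))" "dual_vertex (\<pi> (dual_vertex v))" \<Omega>]
    by (simp add: dual_vertex_mem_iff)
  have "bij_betw (dual_vertex \<circ> \<pi> \<circ> dual_vertex) ?V ?V"
    using to bij from' by (blast intro: bij_betw_trans)
  then show ?thesis
    unfolding graph_automorphism_def comp_apply
    by (intro conjI ballI edge_iff) (simp_all add: comp_def)
qed

lemma cond_C1_dual: "cond_C1 \<Omega> \<Longrightarrow> cond_C1 (complement ` \<Omega>)"
  by (auto simp: cond_C1_def map_butlast[symmetric])

lemma S_all_dual: "S_all (complement ` \<Omega>) = complement ` S_all \<Omega>"
proof -
  have "\<beta> \<in> S_all (complement ` \<Omega>) \<longleftrightarrow> complement \<beta> \<in> S_all \<Omega>" for \<beta>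
    by (auto simp: S_all_def S_at_def mem_complement_image_iff comp_def)
  then show ?thesis
    by (intro set_eqI) (simp only: mem_complement_image_iff)
qed

lemma del_step_complement: "del_step a u v \<Longrightarrow> del_step (\<not> a) (complement u) (complement v)"
proof (induction rule: del_step.induct)
  case (del_first w)
  then show ?case using del_step.del_first[of "\<not> a" "complement w"] by simp
next
  case (del_double u v)
  then show ?case using del_step.del_double[of "\<not> a" "complement u" "complement v"] by simp
qed

lemma del_steps_complement:
  "(del_step a)\<^sup>*\<^sup>* u v \<Longrightarrow> (del_step (\<not> a))\<^sup>*\<^sup>* (complement u) (complement v)"
  by (induction rule: rtranclp_induct)
    (auto intro: rtranclp.rtrancl_into_rtrancl del_step_complement)

lemma H_set_dual: "H_set (\<not> a) (complement ` \<Omega>) \<subseteq> complement ` H_set a \<Omega>"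
proof
  fix \<beta> assume "\<beta> \<in> H_set (\<not> a) (complement ` \<Omega>)"
  then obtain \<alpha> where "\<alpha> \<in> \<Omega>" "(del_step (\<not> a))\<^sup>*\<^sup>* (complement \<alpha>) \<beta>"
    by (auto simp: H_set_def)
  then have "complement \<beta> \<in> H_set a \<Omega>"
    using del_steps_complement[of "\<not> a" "complement \<alpha>" \<beta>] by (auto simp: H_set_def comp_def)
  then show "\<beta> \<in> complement ` H_set a \<Omega>"
    by (simp add: mem_complement_image_iff)
qed

proposition left_vertex_to_zero:
  assumes fin: "finite \<Omega>" and C1: "cond_C1 \<Omega>" and S: "S_all \<Omega> \<subseteq> \<Omega>" and H1: "H_set True \<Omega> \<subseteq> \<Omega>"
    and v: "v \<in> (L_verts \<Omega> :: 'f::{field,finite} vertex set)"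
  shows "\<exists>\<pi>. graph_automorphism (Gamma \<Omega>) \<pi> \<and> \<pi> v = Lvert (zero_vector \<Omega>)"
proof -
  have "dual_vertex v \<in> R_verts (complement ` \<Omega>)"
    using v by (auto simp: L_verts_def R_verts_def dual_vec_mem_iff)
  moreover have "S_all (complement ` \<Omega>) \<subseteq> complement ` \<Omega>"
    using S by (auto simp: S_all_dual)
  moreover have "H_set False (complement ` \<Omega>) \<subseteq> complement ` \<Omega>"
    using H_set_dual[of True \<Omega>] H1 by auto
  ultimately obtain \<pi> where \<pi>: "graph_automorphism (Gamma (complement ` \<Omega>)) \<pi>"
      "\<pi> (dual_vertex v) = Rvert (zero_vector (complement ` \<Omega>))"
    using right_vertex_to_zero[OF finite_imageI[OF fin] cond_C1_dual[OF C1]] by blast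
  have "(dual_vertex \<circ> \<pi> \<circ> dual_vertex) v = Lvert (zero_vector \<Omega>)"
    by (simp add: \<pi>(2) dual_zero_vector)
  then show ?thesis
    using graph_automorphism_dual[OF \<pi>(1)] by blast
qed

theorem theorem2:
  fixes \<Omega> :: "bits set"
  assumes "finite \<Omega>"
    and "cond_C1 \<Omega>"
    and "S_all \<Omega> \<subseteq> \<Omega>"
  shows "(H_set False \<Omega> \<subseteq> \<Omega> \<longrightarrow>
            (\<forall>v \<in> (R_verts \<Omega> :: ('f::{field,finite}) vertex set).
               \<exists>\<pi>. graph_automorphism (Gamma \<Omega>) \<pi> \<and> \<pi> v = Rvert (zero_vector \<Omega>))) \<and>
         (H_set True \<Omega> \<subseteq> \<Omega> \<longrightarrow>
            (\<forall>v \<in> (L_verts \<Omega> :: 'f vertex set).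
               \<exists>\<pi>. graph_automorphism (Gamma \<Omega>) \<pi> \<and> \<pi> v = Lvert (zero_vector \<Omega>)))"
  using right_vertex_to_zero[OF assms] left_vertex_to_zero[OF assms] by blast

end
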